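(* Let $b$ be an enhanced drift (Assumption A) and let $H=H(t,x,p)$ satisfy Assumption C with Lagrangian $L$. Let $h$ be a paracontrolled solution on $[0,T]$ of $$\left(\partial_t+\tfrac12\Delta+b\cdot\nabla\right)h=-H(t,x,\nabla h),\qquad h(T,\cdot)=\bar h,$$ and let $(t,x)\in[0,T]\times\mathbb R^d$. Then: (1) $h(t,x)\ge J(t,x;u)$ for any admissible drift $u$ (with associated controlled martingale solution $\gamma$ started from $(t,x)$). (2) If there exists an admissible $(\Omega^\star,\{\mathcal F^\star_s\},\mathbb P^\star,\gamma^\star,u^\star)$ started from $(t,x)$ such that $$u^\star(s)\in\operatorname*{arg\,max}_{v\in\mathbb R^d}\left[v\cdot\nabla h(s,\gamma^\star_s)-L(s,\gamma^\star_s,v)\right]$$ for $\mathrm{Leb}\times\mathbb P^\star$-a.e. $(s,\omega)\in[t,T]\times\Omega^\star$, then $h(t,x)=J(t,x;u^\star)$, and therefore $$h(t,x)=\sup_v\mathbb E_{t,x}\left[\bar h(\gamma_T^{t,x,v})-\int_t^TL(s,\gamma_s^{t,x,v},v_s)\,ds\right],$$ where the supremum is taken over the class of all admissible $v$.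
   Context: Notation and enhanced drift. Fix $T>0$, $d\ge1$, $\alpha\in(1/2,2/3)$. $\Delta_j$ ($j\ge-1$) are Littlewood–Paley blocks on $\mathbb R^d$; $\mathcal C^\beta=B^\beta_{\infty,\infty}(\mathbb R^d)$. For an interval $I$, $C_IX=C(I;X)$, $C_I^\rho X$ denotes $\rho$-Hölder functions $I\to X$, $C_TX=C_{[0,T]}X$. With $S_j=\sum_{i=-1}^{j-1}\Delta_i$: $f\prec g=\sum_jS_{j-1}f\,\Delta_jg$, $f\succ g=g\prec f$, $f\odot g=\sum_{|i-j|\le1}\Delta_if\,\Delta_jg$. $J^T(f)(t)=\int_t^Te^{(s-t)\Delta/2}f(s)\,ds$. $\mathcal X^\alpha$ is the closure in $C_T\mathcal C^{-\alpha}(\mathbb R^d;\mathbb R^d)\times C_T\mathcal C^{1-2\alpha}(\mathbb R^d;\mathbb R^{d\times d})$ of $\{(\eta,(J^T(\partial_{x_j}\eta^i)\odot\eta^j)_{i,j}):\eta\in C_T\mathcal C^\infty(\mathbb R^d;\mathbb R^d)\}$. Assumption A: $b\in C_T\mathcal C^{-\alpha}(\mathbb R^d;\mathbb R^d)$ is given with $B$ such that $(b,B)\in\mathcal X^\alpha$. Assumption C: $H(t,x,p)=\sup_{v\in\mathbb R^d}\{p\cdot v-L(t,x,v)\}$ for a jointly continuous $L:[0,T]\times\mathbb R^d\times\mathbb R^d\to\mathbb R$ with $\lim_{R\to\infty}\inf_{t,x,|v|\ge R}L(t,x,v)/|v|=+\infty$ and $\sup_{t,x}(|H(t,x,0)|+|L(t,x,0)|)<\infty$.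 Paracontrolled solutions. With $I=[0,T]$, $4/3<a<\theta<\gamma<2-\alpha$ and $\rho\in((\theta-1)/2,(\gamma-1)/2)$, $\mathscr D^{a,\theta,\rho}_{T,T,b}$ is the space of pairs $(u,u')$ with $u\in C_I\mathcal C^\theta$, $\nabla u\in C_I^\rho L^\infty$, $u'\in C_I\mathcal C^{a-1}$ ($\mathbb R^d$-valued) and $u^\sharp:=u-\sum_iu'^i\prec J^T(b^i)$ satisfying $\sup_{t\in I}(T-t)^{(a-1)/2}\|u^\sharp(t)\|_{\mathcal C^{2a-1}}<\infty$. If $(u,\nabla u)$ is in such a space, define $b\cdot\nabla u=\sum_j(b^j\prec\partial_ju+b^j\succ\partial_ju+b^j\odot\partial_ju)$ with $b^j\odot\partial_ju:=b^j\odot\partial_ju^\sharp+\sum_i\big[b^j\odot(\partial_j\partial_iu\prec J^T(b^i))+\mathsf C(\partial_iu,J^T(\partial_jb^i),b^j)+\partial_iu\,B^{i,j}\big]$, where $\mathsf C$ is the continuous extension of $(f,g,h)\mapsto(f\prec g)\odot h-f(g\odot h)$ to $\mathcal C^{\lambda_1}\times\mathcal C^{\lambda_2}\times\mathcal C^{\lambda_3}$, $\lambda_1\in(0,1)$, $\lambda_1+\lambda_2+\lambda_3>0>\lambda_2+\lambda_3$. For $F\in C_TL^\infty$, $u$ is a paracontrolled solution of $(\partial_t+\frac12\Delta+b\cdot\nabla)u=F$, $u(T)=\bar u$ if $(u,\nabla u)$ lies in such a space and $u(t)=e^{(T-t)\Delta/2}\bar u+\int_t^Te^{(s-t)\Delta/2}(b\cdot\nabla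 u-F)(s)\,ds$. A paracontrolled solution of the HJB equation is such a $u$ with $F=-H(\cdot,\cdot,\nabla u)\in C_TL^\infty$, $\bar u=\bar h$. Controlled diffusions. Given a filtered probability space $(\Omega,\mathcal F,(\mathcal F_s),\mathbb P)$ and a progressively measurable $\mathbb R^d$-valued process $v$, an adapted continuous process $\gamma$ is a controlled martingale solution of $\gamma_s=x+\int_t^s(b(r,\gamma_r)+v_r)\,dr+W_s-W_t$, $t\le s\le T$, if $\mathbb P(\gamma_t=x)=1$ and, whenever $\varphi$ is the paracontrolled solution of $(\partial_t+\frac12\Delta+b\cdot\nabla)\varphi=f$, $\varphi(T)=\varphi_T$ with $f\in C_TL^\infty$, $\varphi_T\in\mathcal C^{\gamma'}$, $\gamma'\in(4/3,2-\alpha)$, the process $\varphi(s,\gamma_s)-\varphi(t,x)-\int_t^s(f(r,\gamma_r)+\nabla\varphi(r,\gamma_r)\cdot v_r)\,dr$, $s\in[t,T]$, is a $\mathbb P$-martingale. $(\Omega,\mathcal F,(\mathcal F_s),\mathbb P,v)$ (or just $v$) is admissible if such a $\gamma=\gamma^{t,x,v}$ exists on this space (the space may vary; uniqueness of $\gamma$ is not claimed). The payoff is $J(t,x;v)=\mathbb E_{\mathbb P}\big[\bar h(\gamma_T)-\int_t^TL(s,\gamma_s,v_s)\,ds\big]$, regarded as a function of the whole tuple $(\Omega,\mathcal F,(\mathcal F_s),\mathbb P,v,\gamma)$. *)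

theory Defs
  imports "HOL-Probability.Probability"
begin

section \<open>Smooth functions, Schwartz functions, tempered distributions\<close>

definition partial_deriv :: "'n::finite \<Rightarrow> (real^'n \<Rightarrow> real) \<Rightarrow> real^'n \<Rightarrow> real" where
  "partial_deriv i f x = frechet_derivative f (at x) (axis i 1)"

definition grad :: "(real^'n::finite \<Rightarrow> real) \<Rightarrow> real^'n \<Rightarrow> real^'n" where
  "grad f x = (\<chi> i. partial_deriv i f x)"

definition iter_deriv :: "'n::finite list \<Rightarrow> (real^'n \<Rightarrow> real) \<Rightarrow> real^'n \<Rightarrow> real" where
  "iter_deriv is f = foldr partial_deriv is f"

definition smooth :: "(real^'n::finite \<Rightarrow> real) \<Rightarrow> bool" where
  "smooth f \<longleftrightarrow> (\<forall>is x. iter_deriv is f differentiable (at x))"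

definition schwartz :: "(real^'n::finite \<Rightarrow> real) set" where
  "schwartz = {f. smooth f \<and>
     (\<forall>is (k::nat). bounded (range (\<lambda>x. (1 + norm x) ^ k * iter_deriv is f x)))}"

definition schwartz_norm :: "nat \<Rightarrow> (real^'n::finite \<Rightarrow> real) \<Rightarrow> real" where
  "schwartz_norm N f =
     (\<Sum>is\<in>{is. length is \<le> N}. SUP x. (1 + norm x) ^ N * \<bar>iter_deriv is f x\<bar>)"

text \<open>Distributions are functionals on all functions, but only their values on
  \<^const>\<open>schwartz\<close> are meaningful; two of them are equal as distributions iff they agree there.\<close>

type_synonym 'n dist = "(real^'n \<Rightarrow> real) \<Rightarrow> real"

definition tempered :: "'n::finite dist \<Rightarrow> bool" where
  "tempered u \<longleftrightarrow>
     (\<forall>f\<in>schwartz. \<forall>g\<in>schwartz. \<forall>a b. u (\<lambda>x. a * f x + b * g x) = a * u f + b * u g) \<and>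
     (\<exists>C N. \<forall>f\<in>schwartz. \<bar>u f\<bar> \<le> C * schwartz_norm N f)"

definition dist_of :: "(real^'n::finite \<Rightarrow> real) \<Rightarrow> 'n dist" where
  "dist_of f = (\<lambda>\<phi>. \<integral>x. f x * \<phi> x \<partial>lborel)"

definition dist_deriv :: "'n::finite \<Rightarrow> 'n dist \<Rightarrow> 'n dist" where
  "dist_deriv i u = (\<lambda>\<phi>. - u (partial_deriv i \<phi>))"

definition dist_diff :: "'n::finite dist \<Rightarrow> 'n dist \<Rightarrow> 'n dist" where
  "dist_diff u v = (\<lambda>\<phi>. u \<phi> - v \<phi>)"

text \<open>The semigroup of half the Laplacian on test functions. On distributions it acts by duality
  (the kernel is even), and integrals of distribution-valued curves are taken weakly.\<close>

definition heat :: "real \<Rightarrow> (real^'n::finite \<Rightarrow> real) \<Rightarrow> real^'n \<Rightarrow> real" where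
  "heat r \<phi> x = (if r = 0 then \<phi> x
     else \<integral>y. (2 * pi * r) powr (- real CARD('n) / 2) * exp (- (norm y)\<^sup>2 / (2 * r)) * \<phi> (x - y) \<partial>lborel)"

definition Jop :: "real \<Rightarrow> (real \<Rightarrow> 'n::finite dist) \<Rightarrow> real \<Rightarrow> 'n dist" where
  "Jop T f t = (\<lambda>\<phi>. LINT s:{t..T}|lborel. f s (heat (s - t) \<phi>))"


section \<open>Bounded measurable functions\<close>

definition Linf_norm :: "(real^'n::finite \<Rightarrow> 'b::euclidean_space) \<Rightarrow> ennreal" where
  "Linf_norm f = esssup lborel (\<lambda>x. ennreal (norm (f x)))"

text \<open>An element of \<open>C\<^sub>T L\<^sup>\<infinity>\<close> is given by a jointly Borel representative,
  so that it can be evaluated along the paths of a process.\<close>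

definition CT_Linf :: "real \<Rightarrow> (real \<Rightarrow> real^'n::finite \<Rightarrow> real) \<Rightarrow> bool" where
  "CT_Linf T F \<longleftrightarrow>
     (\<lambda>(t, x). F t x) \<in> borel_measurable (restrict_space borel ({0..T} \<times> UNIV)) \<and>
     (\<forall>t\<in>{0..T}. F t \<in> borel_measurable borel \<and> Linf_norm (F t) < \<infinity> \<and>
        ((\<lambda>s. Linf_norm (\<lambda>x. F s x - F t x)) \<longlongrightarrow> 0) (at t within {0..T}))"

definition CT_holder_Linf :: "real \<Rightarrow> real \<Rightarrow> (real \<Rightarrow> real^'n::finite \<Rightarrow> real^'n) \<Rightarrow> bool" where
  "CT_holder_Linf \<rho> T G \<longleftrightarrow>
     (\<forall>t\<in>{0..T}. G t \<in> borel_measurable borel \<and> Linf_norm (G t) < \<infinity>) \<and>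
     (\<exists>K. \<forall>s\<in>{0..T}. \<forall>t\<in>{0..T}.
        Linf_norm (\<lambda>x. G t x - G s x) \<le> ennreal (K * \<bar>t - s\<bar> powr \<rho>))"


section \<open>Littlewood--Paley blocks, Besov spaces and paraproducts\<close>

definition supp :: "(real^'n::finite \<Rightarrow> real) \<Rightarrow> (real^'n) set" where
  "supp f = closure {\<xi>. f \<xi> \<noteq> 0}"

definition inv_fourier :: "(real^'n::finite \<Rightarrow> real) \<Rightarrow> real^'n \<Rightarrow> complex" where
  "inv_fourier m x = (\<integral>\<xi>. cis (x \<bullet> \<xi>) * complex_of_real (m \<xi>) \<partial>lborel) / (2 * pi) ^ CARD('n)"

text \<open>A dyadic partition of unity, \<open>X\<close> supported in a ball and \<open>R\<close> in an annulus.\<close>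

locale littlewood_paley =
  fixes X R :: "real^'n::finite \<Rightarrow> real"
  assumes smooth: "smooth X" "smooth R"
    and nonneg: "\<And>\<xi>. 0 \<le> X \<xi>" "\<And>\<xi>. 0 \<le> R \<xi>"
    and radial: "\<And>\<xi> \<eta>. norm \<xi> = norm \<eta> \<Longrightarrow> X \<xi> = X \<eta> \<and> R \<xi> = R \<eta>"
    and ball: "\<exists>r. supp X \<subseteq> cball 0 r"
    and annulus: "\<exists>r1 r2. 0 < r1 \<and> supp R \<subseteq> {\<xi>. r1 \<le> norm \<xi> \<and> norm \<xi> \<le> r2}"
    and partition: "\<And>\<xi>. (\<lambda>j::nat. R (\<xi> /\<^sub>R 2 ^ j)) sums (1 - X \<xi>)"
    and disjoint_X: "\<And>j::nat. 1 \<le> j \<Longrightarrow> supp X \<inter> supp (\<lambda>\<xi>. R (\<xi> /\<^sub>R 2 ^ j)) = {}"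
    and disjoint_R: "\<And>i j::nat. i + 2 \<le> j \<Longrightarrow>
          supp (\<lambda>\<xi>. R (\<xi> /\<^sub>R 2 ^ i)) \<inter> supp (\<lambda>\<xi>. R (\<xi> /\<^sub>R 2 ^ j)) = {}"
begin

definition multiplier :: "int \<Rightarrow> real^'n \<Rightarrow> real" where
  "multiplier j \<xi> = (if j = -1 then X \<xi> else R (\<xi> /\<^sub>R 2 ^ nat j))"

text \<open>The Fourier multiplier acts as convolution with its inverse Fourier transform,
  which is real because the multipliers are even. Blocks are meaningful for \<open>j \<ge> -1\<close>.\<close>

definition block :: "int \<Rightarrow> 'n dist \<Rightarrow> real^'n \<Rightarrow> real" where
  "block j u x = u (\<lambda>y. Re (inv_fourier (multiplier j) (x - y)))"

definition low_freq :: "int \<Rightarrow> 'n dist \<Rightarrow> real^'n \<Rightarrow> real" where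
  "low_freq j u x = (\<Sum>i\<in>{-1..j - 1}. block i u x)"

definition besov_norm :: "real \<Rightarrow> 'n dist \<Rightarrow> ennreal" where
  "besov_norm \<beta> u = (SUP j\<in>{-1..}. SUP x. ennreal (2 powr (real_of_int j * \<beta>) * \<bar>block j u x\<bar>))"

definition besov :: "real \<Rightarrow> 'n dist set" where
  "besov \<beta> = {u. tempered u \<and> besov_norm \<beta> u < \<infinity>}"

definition besov_smooth :: "'n dist set" where
  "besov_smooth = (\<Inter>\<beta>. besov \<beta>)"

definition CT_besov :: "real \<Rightarrow> real \<Rightarrow> (real \<Rightarrow> 'n dist) \<Rightarrow> bool" where
  "CT_besov T \<beta> f \<longleftrightarrow> (\<forall>t\<in>{0..T}. f t \<in> besov \<beta> \<and>
     ((\<lambda>s. besov_norm \<beta> (dist_diff (f s) (f t))) \<longlongrightarrow> 0) (at t within {0..T}))"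

definition CT_besov_norm :: "real \<Rightarrow> real \<Rightarrow> (real \<Rightarrow> 'n dist) \<Rightarrow> ennreal" where
  "CT_besov_norm T \<beta> f = (SUP t\<in>{0..T}. besov_norm \<beta> (f t))"

text \<open>The series are series in the space of tempered distributions; the term of index \<open>n\<close>
  belongs to the block \<open>j = n - 1\<close>.\<close>

definition para :: "'n dist \<Rightarrow> 'n dist \<Rightarrow> 'n dist" where
  "para f g = (\<lambda>\<phi>. \<Sum>n. let j = int n - 1 in
     dist_of (\<lambda>x. low_freq (j - 1) f x * block j g x) \<phi>)"

definition resonant :: "'n dist \<Rightarrow> 'n dist \<Rightarrow> 'n dist" where
  "resonant f g = (\<lambda>\<phi>. \<Sum>n. let j = int n - 1 in
     dist_of (\<lambda>x. \<Sum>i\<in>{i. -1 \<le> i \<and> \<bar>i - j\<bar> \<le> 1}. block i f x * block j g x) \<phi>)"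

text \<open>The product, for factors whose regularities have positive sum.\<close>

definition dist_prod :: "'n dist \<Rightarrow> 'n dist \<Rightarrow> 'n dist" where
  "dist_prod f g = (\<lambda>\<phi>. para f g \<phi> + para g f \<phi> + resonant f g \<phi>)"

definition is_commutator :: "('n dist \<Rightarrow> 'n dist \<Rightarrow> 'n dist \<Rightarrow> 'n dist) \<Rightarrow> bool" where
  "is_commutator C \<longleftrightarrow>
     (\<forall>f\<in>besov_smooth. \<forall>g\<in>besov_smooth. \<forall>h\<in>besov_smooth. \<forall>\<phi>\<in>schwartz.
        C f g h \<phi> = resonant (para f g) h \<phi> - dist_prod f (resonant g h) \<phi>) \<and>
     (\<forall>l1 l2 l3. 0 < l1 \<and> l1 < 1 \<and> l1 + l2 + l3 > 0 \<and> 0 > l2 + l3 \<longrightarrow>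
        (\<forall>f\<in>besov l1. \<forall>g\<in>besov l2. \<forall>h\<in>besov l3.
           C f g h \<in> besov (l1 + l2 + l3) \<and>
           (\<forall>e>0. \<exists>d>0. \<forall>f'\<in>besov l1. \<forall>g'\<in>besov l2. \<forall>h'\<in>besov l3.
              besov_norm l1 (dist_diff f' f) < d \<and> besov_norm l2 (dist_diff g' g) < d \<and>
              besov_norm l3 (dist_diff h' h) < d \<longrightarrow>
              besov_norm (l1 + l2 + l3) (dist_diff (C f' g' h') (C f g h)) < e)))"

text \<open>On the spaces in \<^const>\<open>is_commutator\<close> the extension is unique: the truncations
  \<^term>\<open>low_freq N f\<close> converge to \<^term>\<open>f\<close> in every Besov space of slightly lower regularity,
  and the conditions on the exponents are open.\<close>

definition commutator :: "'n dist \<Rightarrow> 'n dist \<Rightarrow> 'n dist \<Rightarrow> 'n dist" where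
  "commutator = (SOME C. is_commutator C)"


section \<open>Enhanced drifts and paracontrolled solutions\<close>

definition enhanced_drift ::
    "real \<Rightarrow> real \<Rightarrow> (real \<Rightarrow> 'n \<Rightarrow> 'n dist) \<Rightarrow> (real \<Rightarrow> 'n \<Rightarrow> 'n \<Rightarrow> 'n dist) \<Rightarrow> bool" where
  "enhanced_drift T \<alpha> b B \<longleftrightarrow>
     (\<forall>i. CT_besov T (- \<alpha>) (\<lambda>t. b t i)) \<and>
     (\<forall>i j. CT_besov T (1 - 2 * \<alpha>) (\<lambda>t. B t i j)) \<and>
     (\<forall>e>0. \<exists>\<eta>. (\<forall>i \<beta>. CT_besov T \<beta> (\<lambda>t. \<eta> t i)) \<and>
        (\<forall>i. CT_besov_norm T (- \<alpha>) (\<lambda>t. dist_diff (b t i) (\<eta> t i)) < e) \<and>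
        (\<forall>i j. CT_besov_norm T (1 - 2 * \<alpha>) (\<lambda>t. dist_diff (B t i j)
           (resonant (Jop T (\<lambda>s. dist_deriv j (\<eta> s i)) t) (\<eta> t j))) < e))"

definition sharp :: "real \<Rightarrow> (real \<Rightarrow> 'n \<Rightarrow> 'n dist) \<Rightarrow>
    (real \<Rightarrow> real^'n \<Rightarrow> real) \<Rightarrow> (real \<Rightarrow> 'n \<Rightarrow> 'n dist) \<Rightarrow> real \<Rightarrow> 'n dist" where
  "sharp T b u u' t =
     (\<lambda>\<phi>. dist_of (u t) \<phi> - (\<Sum>i\<in>UNIV. para (u' t i) (Jop T (\<lambda>s. b s i) t) \<phi>))"

text \<open>At \<open>t = T\<close> the weight vanishes and \<open>0 * \<infinity> = 0\<close> in \<^typ>\<open>ennreal\<close>, so the last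
  condition says nothing about the terminal value. Each \<open>u t\<close> is the continuous representative.\<close>

definition paracontrolled_space :: "real \<Rightarrow> (real \<Rightarrow> 'n \<Rightarrow> 'n dist) \<Rightarrow> real \<Rightarrow> real \<Rightarrow> real \<Rightarrow>
    ((real \<Rightarrow> real^'n \<Rightarrow> real) \<times> (real \<Rightarrow> 'n \<Rightarrow> 'n dist)) set" where
  "paracontrolled_space T b a \<theta> \<rho> = {(u, u').
     (\<forall>t\<in>{0..T}. u t \<in> bcontfun) \<and>
     CT_besov T \<theta> (\<lambda>t. dist_of (u t)) \<and>
     CT_holder_Linf \<rho> T (\<lambda>t. grad (u t)) \<and>
     (\<forall>i. CT_besov T (a - 1) (\<lambda>t. u' t i)) \<and>
     (SUP t\<in>{0..T}. ennreal ((T - t) powr ((a - 1) / 2)) *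
        besov_norm (2 * a - 1) (sharp T b u u' t)) < \<infinity>}"

definition dist_grad :: "(real \<Rightarrow> real^'n \<Rightarrow> real) \<Rightarrow> real \<Rightarrow> 'n \<Rightarrow> 'n dist" where
  "dist_grad u t i = dist_deriv i (dist_of (u t))"

definition in_paracontrolled_space ::
    "real \<Rightarrow> real \<Rightarrow> (real \<Rightarrow> 'n \<Rightarrow> 'n dist) \<Rightarrow> (real \<Rightarrow> real^'n \<Rightarrow> real) \<Rightarrow> bool" where
  "in_paracontrolled_space T \<alpha> b u \<longleftrightarrow>
     (\<exists>a \<theta> \<gamma> \<rho>. 4 / 3 < a \<and> a < \<theta> \<and> \<theta> < \<gamma> \<and> \<gamma> < 2 - \<alpha> \<and>
        (\<theta> - 1) / 2 < \<rho> \<and> \<rho> < (\<gamma> - 1) / 2 \<and>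
        (u, dist_grad u) \<in> paracontrolled_space T b a \<theta> \<rho>)"

definition drift_resonant :: "real \<Rightarrow> (real \<Rightarrow> 'n \<Rightarrow> 'n dist) \<Rightarrow> (real \<Rightarrow> 'n \<Rightarrow> 'n \<Rightarrow> 'n dist) \<Rightarrow>
    (real \<Rightarrow> real^'n \<Rightarrow> real) \<Rightarrow> real \<Rightarrow> 'n \<Rightarrow> 'n dist" where
  "drift_resonant T b B u t j = (\<lambda>\<phi>.
     resonant (b t j) (dist_deriv j (sharp T b u (dist_grad u) t)) \<phi> +
     (\<Sum>i\<in>UNIV.
        resonant (b t j) (para (dist_deriv j (dist_grad u t i)) (Jop T (\<lambda>s. b s i) t)) \<phi> +
        commutator (dist_grad u t i) (Jop T (\<lambda>s. dist_deriv j (b s i)) t) (b t j) \<phi> +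
        dist_prod (dist_grad u t i) (B t i j) \<phi>))"

definition drift_term :: "real \<Rightarrow> (real \<Rightarrow> 'n \<Rightarrow> 'n dist) \<Rightarrow> (real \<Rightarrow> 'n \<Rightarrow> 'n \<Rightarrow> 'n dist) \<Rightarrow>
    (real \<Rightarrow> real^'n \<Rightarrow> real) \<Rightarrow> real \<Rightarrow> 'n dist" where
  "drift_term T b B u t = (\<lambda>\<phi>. \<Sum>j\<in>UNIV.
     para (b t j) (dist_grad u t j) \<phi> + para (dist_grad u t j) (b t j) \<phi> +
     drift_resonant T b B u t j \<phi>)"

definition paracontrolled_solution :: "real \<Rightarrow> real \<Rightarrow> (real \<Rightarrow> 'n \<Rightarrow> 'n dist) \<Rightarrow>
    (real \<Rightarrow> 'n \<Rightarrow> 'n \<Rightarrow> 'n dist) \<Rightarrow> (real \<Rightarrow> real^'n \<Rightarrow> real) \<Rightarrow> (real^'n \<Rightarrow> real) \<Rightarrow>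
    (real \<Rightarrow> real^'n \<Rightarrow> real) \<Rightarrow> bool" where
  "paracontrolled_solution T \<alpha> b B F ubar u \<longleftrightarrow>
     CT_Linf T F \<and> in_paracontrolled_space T \<alpha> b u \<and> u T = ubar \<and>
     (\<forall>t\<in>{0..T}. \<forall>\<phi>\<in>schwartz.
        dist_of (u t) \<phi> = dist_of ubar (heat (T - t) \<phi>) +
          (LINT s:{t..T}|lborel. drift_term T b B u s (heat (s - t) \<phi>)
                                 - dist_of (F s) (heat (s - t) \<phi>)))"

definition hjb_solution :: "real \<Rightarrow> real \<Rightarrow> (real \<Rightarrow> 'n \<Rightarrow> 'n dist) \<Rightarrow>
    (real \<Rightarrow> 'n \<Rightarrow> 'n \<Rightarrow> 'n dist) \<Rightarrow> (real \<Rightarrow> real^'n \<Rightarrow> real^'n \<Rightarrow> real) \<Rightarrow> (real^'n \<Rightarrow> real) \<Rightarrow>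
    (real \<Rightarrow> real^'n \<Rightarrow> real) \<Rightarrow> bool" where
  "hjb_solution T \<alpha> b B H hbar h \<longleftrightarrow>
     paracontrolled_solution T \<alpha> b B (\<lambda>t x. - H t x (grad (h t) x)) hbar h"

end


section \<open>Hamiltonian and Lagrangian\<close>

definition hamiltonian_of :: "real \<Rightarrow> (real \<Rightarrow> real^'n::finite \<Rightarrow> real^'n \<Rightarrow> real) \<Rightarrow>
    (real \<Rightarrow> real^'n \<Rightarrow> real^'n \<Rightarrow> real) \<Rightarrow> bool" where
  "hamiltonian_of T L H \<longleftrightarrow>
     (\<forall>t\<in>{0..T}. \<forall>x p. ereal (H t x p) = (SUP v. ereal (p \<bullet> v - L t x v))) \<and>
     continuous_on ({0..T} \<times> UNIV \<times> UNIV) (\<lambda>(t, x, v). L t x v) \<and>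
     ((\<lambda>r. INF (t, x, v)\<in>{0..T} \<times> UNIV \<times> {v. r \<le> norm v}. ereal (L t x v / norm v))
        \<longlongrightarrow> \<infinity>) at_top \<and>
     (SUP (t, x)\<in>{0..T} \<times> UNIV. ereal (\<bar>H t x 0\<bar> + \<bar>L t x 0\<bar>)) < \<infinity>"


section \<open>Controlled diffusions\<close>

definition martingale_on ::
    "'w measure \<Rightarrow> (real \<Rightarrow> 'w measure) \<Rightarrow> real set \<Rightarrow> (real \<Rightarrow> 'w \<Rightarrow> real) \<Rightarrow> bool" where
  "martingale_on M \<F> I Y \<longleftrightarrow>
     (\<forall>s\<in>I. Y s \<in> borel_measurable (\<F> s) \<and> integrable M (Y s)) \<and>
     (\<forall>s\<in>I. \<forall>r\<in>I. s \<le> r \<longrightarrow> (AE \<omega> in M. real_cond_exp M (\<F> s) (Y r) \<omega> = Y s \<omega>))"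

definition filtered_prob_space :: "'w measure \<Rightarrow> (real \<Rightarrow> 'w measure) \<Rightarrow> bool" where
  "filtered_prob_space M \<F> \<longleftrightarrow>
     prob_space M \<and> filtration (space M) \<F> \<and> (\<forall>s. subalgebra M (\<F> s))"

definition progressive_on :: "(real \<Rightarrow> 'w measure) \<Rightarrow> real \<Rightarrow> real \<Rightarrow>
    (real \<Rightarrow> 'w \<Rightarrow> real^'n::finite) \<Rightarrow> bool" where
  "progressive_on \<F> t T v \<longleftrightarrow> (\<forall>s\<in>{t..T}.
     (\<lambda>(r, \<omega>). v r \<omega>) \<in> borel_measurable (restrict_space borel {t..s} \<Otimes>\<^sub>M \<F> s))"

text \<open>The Bochner integral of a non-integrable function is \<open>0\<close>; integrability along almost every
  path is therefore part of the definition.\<close>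

definition (in littlewood_paley) controlled_martingale_solution ::
    "real \<Rightarrow> real \<Rightarrow> (real \<Rightarrow> 'n \<Rightarrow> 'n dist) \<Rightarrow> (real \<Rightarrow> 'n \<Rightarrow> 'n \<Rightarrow> 'n dist) \<Rightarrow> real \<Rightarrow> real^'n \<Rightarrow>
     'w measure \<Rightarrow> (real \<Rightarrow> 'w measure) \<Rightarrow> (real \<Rightarrow> 'w \<Rightarrow> real^'n) \<Rightarrow> (real \<Rightarrow> 'w \<Rightarrow> real^'n) \<Rightarrow> bool"
  where
  "controlled_martingale_solution T \<alpha> b B t x M \<F> v \<gamma> \<longleftrightarrow>
     (\<forall>s\<in>{t..T}. \<gamma> s \<in> borel_measurable (\<F> s)) \<and>
     (\<forall>\<omega>\<in>space M. continuous_on {t..T} (\<lambda>s. \<gamma> s \<omega>)) \<and>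
     (AE \<omega> in M. \<gamma> t \<omega> = x) \<and>
     (\<forall>\<phi> f \<phi>T \<gamma>'. 4 / 3 < \<gamma>' \<and> \<gamma>' < 2 - \<alpha> \<and> CT_Linf T f \<and> dist_of \<phi>T \<in> besov \<gamma>' \<and>
        paracontrolled_solution T \<alpha> b B f \<phi>T \<phi> \<longrightarrow>
        (AE \<omega> in M. set_integrable lborel {t..T}
           (\<lambda>r. f r (\<gamma> r \<omega>) + grad (\<phi> r) (\<gamma> r \<omega>) \<bullet> v r \<omega>)) \<and>
        martingale_on M \<F> {t..T} (\<lambda>s \<omega>. \<phi> s (\<gamma> s \<omega>) - \<phi> t x -
           (LINT r:{t..s}|lborel. f r (\<gamma> r \<omega>) + grad (\<phi> r) (\<gamma> r \<omega>) \<bullet> v r \<omega>)))"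

definition (in littlewood_paley) admissible ::
    "real \<Rightarrow> real \<Rightarrow> (real \<Rightarrow> 'n \<Rightarrow> 'n dist) \<Rightarrow> (real \<Rightarrow> 'n \<Rightarrow> 'n \<Rightarrow> 'n dist) \<Rightarrow> real \<Rightarrow> real^'n \<Rightarrow>
     'w measure \<Rightarrow> (real \<Rightarrow> 'w measure) \<Rightarrow> (real \<Rightarrow> 'w \<Rightarrow> real^'n) \<Rightarrow> (real \<Rightarrow> 'w \<Rightarrow> real^'n) \<Rightarrow> bool"
  where
  "admissible T \<alpha> b B t x M \<F> v \<gamma> \<longleftrightarrow>
     filtered_prob_space M \<F> \<and> progressive_on \<F> t T v \<and>
     controlled_martingale_solution T \<alpha> b B t x M \<F> v \<gamma>"

text \<open>Positive minus negative part, since the running cost need not be integrable. In the payoff the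
  indeterminate case (where \<open>\<infinity> - \<infinity> = \<infinity>\<close> in \<^typ>\<open>ereal\<close>) does not occur: the Lagrangian is bounded
  below by the bound on \<open>H(t, x, 0)\<close>, and the terminal value is bounded.\<close>

definition ext_integral :: "'a measure \<Rightarrow> ('a \<Rightarrow> ereal) \<Rightarrow> ereal" where
  "ext_integral M f =
     enn2ereal (\<integral>\<^sup>+ x. e2ennreal (f x) \<partial>M) - enn2ereal (\<integral>\<^sup>+ x. e2ennreal (- f x) \<partial>M)"

definition payoff :: "real \<Rightarrow> (real \<Rightarrow> real^'n::finite \<Rightarrow> real^'n \<Rightarrow> real) \<Rightarrow> (real^'n \<Rightarrow> real) \<Rightarrow>
    real \<Rightarrow> 'w measure \<Rightarrow> (real \<Rightarrow> 'w \<Rightarrow> real^'n) \<Rightarrow> (real \<Rightarrow> 'w \<Rightarrow> real^'n) \<Rightarrow> ereal" where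
  "payoff T L hbar t M v \<gamma> =
     ext_integral M (\<lambda>\<omega>. ereal (hbar (\<gamma> T \<omega>)) -
       ext_integral (restrict_space lborel {t..T}) (\<lambda>s. ereal (L s (\<gamma> s \<omega>) (v s \<omega>))))"

definition (in littlewood_paley) payoffs ::
    "'w itself \<Rightarrow> real \<Rightarrow> real \<Rightarrow> (real \<Rightarrow> 'n \<Rightarrow> 'n dist) \<Rightarrow> (real \<Rightarrow> 'n \<Rightarrow> 'n \<Rightarrow> 'n dist) \<Rightarrow>
     (real \<Rightarrow> real^'n \<Rightarrow> real^'n \<Rightarrow> real) \<Rightarrow> (real^'n \<Rightarrow> real) \<Rightarrow> real \<Rightarrow> real^'n \<Rightarrow> ereal set" where
  "payoffs _ T \<alpha> b B L hbar t x =
     {payoff T L hbar t M v \<gamma> | (M :: 'w measure) \<F> v \<gamma>. admissible T \<alpha> b B t x M \<F> v \<gamma>}"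

end

theory Submission
  imports Defs
begin

text \<open>A paracontrolled solution of the Hamilton--Jacobi--Bellman equation is itself an admissible test
  function in the martingale problem of every controlled diffusion: its terminal value inherits the
  regularity of the solution. Taking expectations of the resulting martingale between the initial
  and the terminal time writes \<open>h t x\<close> as the payoff in which the running cost \<open>L\<close> is replaced by
  \<open>v \<bullet> grad h - H\<close>. By duality this integrand is at most \<open>L\<close>, and it equals \<open>L\<close> where the control is a
  maximiser. Only monotonicity of \<^const>\<open>ext_integral\<close> is used in the comparison, which does not require
  the running cost to be measurable.\<close>

text \<open>The nonnegative integral is monotone without any measurability, and subtraction in
  \<open>ereal\<close> stays monotone in the indeterminate case because there
  \<open>\<infinity> - \<infinity> = \<infinity>\<close>.\<close>

lemma ext_integral_mono_AE:
  assumes "AE x in M. f x \<le> g x"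
  shows "ext_integral M f \<le> ext_integral M g"
  unfolding ext_integral_def
proof (rule ereal_minus_mono)
  show "enn2ereal (\<integral>\<^sup>+ x. e2ennreal (f x) \<partial>M) \<le> enn2ereal (\<integral>\<^sup>+ x. e2ennreal (g x) \<partial>M)"
    using assms by (auto simp flip: less_eq_ennreal.rep_eq intro!: nn_integral_mono_AE e2ennreal_mono)
  show "enn2ereal (\<integral>\<^sup>+ x. e2ennreal (- g x) \<partial>M) \<le> enn2ereal (\<integral>\<^sup>+ x. e2ennreal (- f x) \<partial>M)"
    using assms by (auto simp flip: less_eq_ennreal.rep_eq intro!: nn_integral_mono_AE e2ennreal_mono)
qed

lemma ext_integral_cong_AE:
  assumes "AE x in M. f x = g x"
  shows "ext_integral M f = ext_integral M g"
  using assms by (intro antisym ext_integral_mono_AE) auto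

text \<open>Integrability makes both parts finite, so the difference in \<open>ereal\<close> is the
  real difference that computes the Bochner integral.\<close>

lemma ext_integral_ereal:
  assumes "integrable M f"
  shows "ext_integral M (\<lambda>x. ereal (f x)) = ereal (integral\<^sup>L M f)"
proof -
  have fin: "(\<integral>\<^sup>+ x. ennreal (f x) \<partial>M) < \<top>" "(\<integral>\<^sup>+ x. ennreal (- f x) \<partial>M) < \<top>"
    using assms by (auto simp: real_integrable_def less_top)
  have "enn2ereal a = ereal (enn2real a)" if "a < \<top>" for a
    using that by (cases a) auto
  with fin show ?thesis
    by (simp add: ext_integral_def real_lebesgue_integral_def[OF assms])
qed

lemma ext_integral_restrict_space:
  fixes f :: "'a \<Rightarrow> real"
  assumes "A \<in> sets M" and "set_integrable M A f"
  shows "ext_integral (restrict_space M A) (\<lambda>x. ereal (f x)) = ereal (LINT x:A|M. f x)"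
  using assms
  by (subst ext_integral_ereal)
    (auto simp: integrable_restrict_space integral_restrict_space
      set_integrable_def set_lebesgue_integral_def)

text \<open>The maximality of the control holds almost everywhere on time times
  \<open>\<Omega>\<close>, while the payoff integrates over time along a fixed path. Transporting
  the null set by the coordinate swap gives a statement for almost every path.\<close>

lemma AE_pair_swap:
  assumes "sigma_finite_measure M1" "sigma_finite_measure M2"
    and "AE z in M1 \<Otimes>\<^sub>M M2. Q z"
  shows "AE y in M2. AE x in M1. Q (x, y)"
proof -
  interpret pair_sigma_finite M2 M1
    using assms by (simp add: pair_sigma_finite_def)
  have "AE z in distr (M2 \<Otimes>\<^sub>M M1) (M1 \<Otimes>\<^sub>M M2) (\<lambda>(x, y). (y, x)). Q z"
    using assms(3) unfolding pair_sigma_finite.distr_pair_swap[OF pair_sigma_finite.intro[OF assms(1,2)], symmetric] .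
  then have "AE z in M2 \<Otimes>\<^sub>M M1. Q (case z of (x, y) \<Rightarrow> (y, x))"
    by (rule AE_distrD[rotated]) simp
  from AE_pair[OF this] show ?thesis by simp
qed

text \<open>Fenchel-Young inequality for the Legendre transform of \<open>L\<close> in the
  velocity.\<close>

lemma hamiltonian_of_ge:
  assumes "hamiltonian_of T L H" and "t \<in> {0..T}"
  shows "p \<bullet> v - L t x v \<le> H t x p"
proof -
  have "ereal (p \<bullet> v - L t x v) \<le> (SUP v. ereal (p \<bullet> v - L t x v))"
    by (rule SUP_upper) simp
  also have "\<dots> = ereal (H t x p)"
    using assms by (simp add: hamiltonian_of_def)
  finally show ?thesis by simp
qed

text \<open>Equality case of Fenchel-Young: at a maximiser the supremum defining \<open>H\<close> is
  attained.\<close>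

lemma hamiltonian_of_arg_max:
  assumes "hamiltonian_of T L H" and "t \<in> {0..T}"
    and "is_arg_max (\<lambda>v. v \<bullet> p - L t x v) (\<lambda>_. True) v"
  shows "p \<bullet> v - L t x v = H t x p"
proof (rule antisym)
  have "ereal (H t x p) = (SUP v. ereal (p \<bullet> v - L t x v))"
    using assms by (simp add: hamiltonian_of_def)
  also have "\<dots> \<le> ereal (p \<bullet> v - L t x v)"
    using assms(3) by (intro SUP_least) (auto simp: is_arg_max_def inner_commute not_less)
  finally show "H t x p \<le> p \<bullet> v - L t x v" by simp
qed (rule hamiltonian_of_ge[OF assms(1,2)])

text \<open>Conditional expectation given \<open>\<F> s\<close> preserves the integral, and for a
  martingale it turns \<open>Y r\<close> into \<open>Y s\<close> almost surely.\<close>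

lemma martingale_on_integral_eq:
  assumes "filtered_prob_space M \<F>" and "martingale_on M \<F> I Y"
    and "s \<in> I" "r \<in> I" "s \<le> r"
  shows "integral\<^sup>L M (Y r) = integral\<^sup>L M (Y s)"
proof -
  interpret prob_space M
    using assms(1) by (simp add: filtered_prob_space_def)
  interpret finite_measure_subalgebra M "\<F> s"
    using assms(1) by unfold_locales (simp add: filtered_prob_space_def)
  have Y: "integrable M (Y r)" "integrable M (Y s)"
    "AE \<omega> in M. real_cond_exp M (\<F> s) (Y r) \<omega> = Y s \<omega>"
    using assms by (auto simp: martingale_on_def)
  have "integral\<^sup>L M (Y r) = integral\<^sup>L M (real_cond_exp M (\<F> s) (Y r))"
    using real_cond_exp_int[OF Y(1)] by simp
  also have "\<dots> = integral\<^sup>L M (Y s)"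
    using Y real_cond_exp_int[OF Y(1)] by (intro integral_cong_AE) auto
  finally show ?thesis .
qed

context littlewood_paley
begin

lemma in_paracontrolled_space_besov:
  assumes "in_paracontrolled_space T \<alpha> b u" and "t \<in> {0..T}"
  shows "\<exists>\<gamma>'. 4 / 3 < \<gamma>' \<and> \<gamma>' < 2 - \<alpha> \<and> dist_of (u t) \<in> besov \<gamma>'"
proof -
  obtain a \<theta> \<gamma> \<rho> where "4 / 3 < a" "a < \<theta>" "\<theta> < \<gamma>" "\<gamma> < 2 - \<alpha>"
    and "(u, dist_grad u) \<in> paracontrolled_space T b a \<theta> \<rho>"
    using assms(1) unfolding in_paracontrolled_space_def by blast
  then show ?thesis
    \<comment> \<open>The exponent \<open>\<theta>\<close> of the solution space is a valid witness,
      since 4/3 < \<open>a\<close> < \<open>\<theta>\<close> < \<open>\<gamma>\<close> < 2 -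
      \<open>\<alpha>\<close>.\<close>
    using assms(2) by (intro exI[of _ \<theta>]) (auto simp: paracontrolled_space_def CT_besov_def)
qed

context
  fixes T \<alpha> :: real and b :: "real \<Rightarrow> 'n \<Rightarrow> 'n dist" and B :: "real \<Rightarrow> 'n \<Rightarrow> 'n \<Rightarrow> 'n dist"
    and L H :: "real \<Rightarrow> real^'n \<Rightarrow> real^'n \<Rightarrow> real" and hbar :: "real^'n \<Rightarrow> real"
    and h :: "real \<Rightarrow> real^'n \<Rightarrow> real" and t :: real and x :: "real^'n"
    and M :: "'w measure" and \<F> :: "real \<Rightarrow> 'w measure" and v \<gamma> :: "real \<Rightarrow> 'w \<Rightarrow> real^'n"
  assumes hjb: "hjb_solution T \<alpha> b B H hbar h"
    and t: "t \<in> {0..T}"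
    and adm: "admissible T \<alpha> b B t x M \<F> v \<gamma>"
begin

text \<open>A verification formula: since \<open>h\<close> has right-hand side \<open>-H\<close>
  evaluated at its own gradient, \<open>g\<close> is exactly the drift of \<open>h\<close> along the
  controlled path. The value \<open>h t x\<close> is thus a payoff with running cost
  \<open>g\<close> in place of \<open>L\<close>.\<close>

lemma hjb_solution_representation:
  defines "g \<equiv> \<lambda>\<omega> r. grad (h r) (\<gamma> r \<omega>) \<bullet> v r \<omega> - H r (\<gamma> r \<omega>) (grad (h r) (\<gamma> r \<omega>))"
  shows "AE \<omega> in M. set_integrable lborel {t..T} (g \<omega>)"
    and "ext_integral M (\<lambda>\<omega>. ereal (hbar (\<gamma> T \<omega>)) -
           ext_integral (restrict_space lborel {t..T}) (\<lambda>r. ereal (g \<omega> r))) = ereal (h t x)"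
proof -
  define f where "f \<equiv> \<lambda>t x. - H t x (grad (h t) x)"
  have sol: "paracontrolled_solution T \<alpha> b B f hbar h"
    using hjb by (simp add: hjb_solution_def f_def)
  then have CT: "CT_Linf T f" and par: "in_paracontrolled_space T \<alpha> b h" and hT: "h T = hbar"
    by (auto simp: paracontrolled_solution_def)
  obtain \<gamma>' where \<gamma>': "4 / 3 < \<gamma>'" "\<gamma>' < 2 - \<alpha>" "dist_of hbar \<in> besov \<gamma>'"
    using in_paracontrolled_space_besov[OF par, of T] t hT by auto
  have filt: "filtered_prob_space M \<F>"
    and sol_\<gamma>: "controlled_martingale_solution T \<alpha> b B t x M \<F> v \<gamma>"
    using adm by (auto simp: admissible_def)
  interpret prob_space M
    using filt by (simp add: filtered_prob_space_def)
  define Y where "Y \<equiv> \<lambda>s \<omega>. h s (\<gamma> s \<omega>) - h t x - (LINT r:{t..s}|lborel. g \<omega> r)"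
  have g_eq: "g = (\<lambda>\<omega> r. f r (\<gamma> r \<omega>) + grad (h r) (\<gamma> r \<omega>) \<bullet> v r \<omega>)"
    by (auto simp: g_def f_def)
  \<comment> \<open>The martingale problem is tested with \<open>h\<close> itself, with source
    \<open>f\<close> and terminal value \<open>hbar\<close>.\<close>
  have start: "AE \<omega> in M. \<gamma> t \<omega> = x"
    and g_int: "AE \<omega> in M. set_integrable lborel {t..T} (g \<omega>)"
    and mart: "martingale_on M \<F> {t..T} Y"
    using sol_\<gamma> CT \<gamma>' sol unfolding controlled_martingale_solution_def Y_def g_eq by blast+
  show "AE \<omega> in M. set_integrable lborel {t..T} (g \<omega>)" by (fact g_int)
  have Y_int: "integrable M (Y s)" if "s \<in> {t..T}" for s
    using mart that by (simp add: martingale_on_def)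
  \<comment> \<open>At the initial time the path sits at \<open>x\<close> almost surely and the
    integral runs over a single point, a null set.\<close>
  have "AE \<omega> in M. Y t \<omega> = 0"
    using start
  proof eventually_elim
    case (elim \<omega>)
    have "(LINT r:{t..t}|lborel. g \<omega> r) = 0"
      unfolding set_lebesgue_integral_def
      by (intro integral_eq_zero_AE AE_I[of _ _ "{t}"]) (auto simp: indicator_def)
    with elim show ?case by (simp add: Y_def)
  qed
  then have "integral\<^sup>L M (Y t) = 0"
    by (rule integral_eq_zero_AE)
  then have Y_zero: "integral\<^sup>L M (Y T) = 0"
    using martingale_on_integral_eq[OF filt mart, of t T] t by simp
  have YT: "integrable M (Y T)" using Y_int t by simp
  \<comment> \<open>On almost every path \<open>g\<close> is integrable, so the inner extended
    integral is the one in \<open>Y T\<close>. As \<open>h T = hbar\<close>, the integrand is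
    \<open>Y T\<close> shifted by the constant \<open>h t x\<close>.\<close>
  have "ext_integral M (\<lambda>\<omega>. ereal (hbar (\<gamma> T \<omega>)) -
          ext_integral (restrict_space lborel {t..T}) (\<lambda>r. ereal (g \<omega> r)))
      = ext_integral M (\<lambda>\<omega>. ereal (Y T \<omega> + h t x))"
    using g_int
    by (intro ext_integral_cong_AE, eventually_elim)
      (simp add: ext_integral_restrict_space Y_def hT)
  also have "\<dots> = ereal (h t x)"
    using YT by (subst ext_integral_ereal) (auto simp: Y_zero prob_space)
  finally show "ext_integral M (\<lambda>\<omega>. ereal (hbar (\<gamma> T \<omega>)) -
      ext_integral (restrict_space lborel {t..T}) (\<lambda>r. ereal (g \<omega> r))) = ereal (h t x)" .
qed

lemma payoff_le_hjb_solution: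
  assumes ham: "hamiltonian_of T L H"
  shows "payoff T L hbar t M v \<gamma> \<le> ereal (h t x)"
  \<comment> \<open>With \<open>h t x\<close> rewritten as the payoff with running cost
    \<open>g\<close>, both sides differ in the running cost alone, and it remains to show that
    \<open>g\<close> is at most \<open>L\<close> at every time and on every path.\<close>
  unfolding payoff_def hjb_solution_representation(2)[symmetric]
proof (intro ext_integral_mono_AE AE_I2 ereal_minus_mono order_refl)
  fix \<omega> s assume "s \<in> space (restrict_space lborel {t..T})"
  then have "s \<in> {0..T}" using t by (auto simp: space_restrict_space)
  from hamiltonian_of_ge[OF ham this]
  have "grad (h s) (\<gamma> s \<omega>) \<bullet> v s \<omega> - L s (\<gamma> s \<omega>) (v s \<omega>) \<le> H s (\<gamma> s \<omega>) (grad (h s) (\<gamma> s \<omega>))" .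
  then show "ereal (grad (h s) (\<gamma> s \<omega>) \<bullet> v s \<omega> - H s (\<gamma> s \<omega>) (grad (h s) (\<gamma> s \<omega>)))
      \<le> ereal (L s (\<gamma> s \<omega>) (v s \<omega>))"
    by simp
qed

lemma payoff_eq_hjb_solution:
  assumes ham: "hamiltonian_of T L H"
    and arg_max: "AE (s, \<omega>) in restrict_space lborel {t..T} \<Otimes>\<^sub>M M.
      is_arg_max (\<lambda>w. w \<bullet> grad (h s) (\<gamma> s \<omega>) - L s (\<gamma> s \<omega>) w) (\<lambda>_. True) (v s \<omega>)"
  shows "payoff T L hbar t M v \<gamma> = ereal (h t x)"
proof -
  interpret prob_space M
    using adm by (simp add: admissible_def filtered_prob_space_def)
  have "AE \<omega> in M. AE s in restrict_space lborel {t..T}.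
      is_arg_max (\<lambda>w. w \<bullet> grad (h s) (\<gamma> s \<omega>) - L s (\<gamma> s \<omega>) w) (\<lambda>_. True) (v s \<omega>)"
    using AE_pair_swap[OF _ _ arg_max] sigma_finite_measure_axioms
    by (simp add: sigma_finite_measure_restrict_space sigma_finite_lborel)
  then have "AE \<omega> in M. AE s in restrict_space lborel {t..T}.
      L s (\<gamma> s \<omega>) (v s \<omega>) = grad (h s) (\<gamma> s \<omega>) \<bullet> v s \<omega> - H s (\<gamma> s \<omega>) (grad (h s) (\<gamma> s \<omega>))"
  proof eventually_elim
    case (elim \<omega>)
    \<comment> \<open>The duality between \<open>L\<close> and \<open>H\<close> is available on the
      time interval from 0 to \<open>T\<close>, so membership of the time is carried along.\<close>
    moreover have "AE s in restrict_space lborel {t..T}. s \<in> {0..T}"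
      using t by (intro AE_I2) (auto simp: space_restrict_space)
    ultimately show ?case
    proof eventually_elim
      case (elim s)
      from hamiltonian_of_arg_max[OF ham elim(2,1)] show ?case by simp
    qed
  qed
  then show ?thesis
    unfolding payoff_def hjb_solution_representation(2)[symmetric]
  proof (intro ext_integral_cong_AE, eventually_elim)
    case (elim \<omega>)
    then show ?case
      by (intro arg_cong2[where f = minus] refl ext_integral_cong_AE) auto
  qed
qed

end

lemma payoffs_le_hjb_solution:
  assumes "hjb_solution T \<alpha> b B H hbar h" "t \<in> {0..T}" "hamiltonian_of T L H"
    and "y \<in> payoffs TYPE('w) T \<alpha> b B L hbar t x"
  shows "y \<le> ereal (h t x)"
  using assms by (auto simp: payoffs_def intro: payoff_le_hjb_solution)

end

theorem proposition4p2:
  fixes X R :: "real^'n::finite \<Rightarrow> real"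
    and T \<alpha> :: real
    and b :: "real \<Rightarrow> 'n \<Rightarrow> 'n dist"
    and B :: "real \<Rightarrow> 'n \<Rightarrow> 'n \<Rightarrow> 'n dist"
    and L H :: "real \<Rightarrow> real^'n \<Rightarrow> real^'n \<Rightarrow> real"
    and hbar :: "real^'n \<Rightarrow> real"
    and h :: "real \<Rightarrow> real^'n \<Rightarrow> real"
    and t :: real and x :: "real^'n"
  assumes "littlewood_paley X R"
    and "0 < T" and "1 / 2 < \<alpha>" and "\<alpha> < 2 / 3"
    and "littlewood_paley.enhanced_drift X R T \<alpha> b B"
    and "hamiltonian_of T L H"
    and "littlewood_paley.hjb_solution X R T \<alpha> b B H hbar h"
    and "t \<in> {0..T}"
  shows "(\<forall>(M :: 'v measure) \<F> u \<gamma>.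
            littlewood_paley.admissible X R T \<alpha> b B t x M \<F> u \<gamma> \<longrightarrow>
            payoff T L hbar t M u \<gamma> \<le> ereal (h t x)) \<and>
         (\<forall>(M :: 'w measure) \<F> u \<gamma>.
            littlewood_paley.admissible X R T \<alpha> b B t x M \<F> u \<gamma> \<and>
            (AE (s, \<omega>) in restrict_space lborel {t..T} \<Otimes>\<^sub>M M.
               is_arg_max (\<lambda>v. v \<bullet> grad (h s) (\<gamma> s \<omega>) - L s (\<gamma> s \<omega>) v) (\<lambda>_. True) (u s \<omega>)) \<longrightarrow>
            ereal (h t x) = payoff T L hbar t M u \<gamma> \<and>
            ereal (h t x) = Sup (littlewood_paley.payoffs X R TYPE('w) T \<alpha> b B L hbar t x \<union>
                                 littlewood_paley.payoffs X R TYPE('v) T \<alpha> b B L hbar t x))"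
proof -
  interpret littlewood_paley X R by fact
  \<comment> \<open>The type of the sample space stays schematic here: the bound is used at
    \<open>'v\<close>, the equality at \<open>'w\<close>.\<close>
  note bounds = payoff_le_hjb_solution[OF assms(7,8) _ assms(6)]
    payoff_eq_hjb_solution[OF assms(7,8) _ assms(6)]
  show ?thesis
  proof (intro conjI allI impI; (elim conjE)?)
    fix M :: "'v measure" and \<F> u \<gamma>
    assume "admissible T \<alpha> b B t x M \<F> u \<gamma>"
    then show "payoff T L hbar t M u \<gamma> \<le> ereal (h t x)"
      by (rule bounds(1))
  next
    fix M :: "'w measure" and \<F> u \<gamma>
    assume adm: "admissible T \<alpha> b B t x M \<F> u \<gamma>"
      and "AE (s, \<omega>) in restrict_space lborel {t..T} \<Otimes>\<^sub>M M.
        is_arg_max (\<lambda>v. v \<bullet> grad (h s) (\<gamma> s \<omega>) - L s (\<gamma> s \<omega>) v) (\<lambda>_. True) (u s \<omega>)"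
    then show eq: "ereal (h t x) = payoff T L hbar t M u \<gamma>"
      by (rule bounds(2)[symmetric])
    \<comment> \<open>The supremum is a maximum: the optimal control attains the value among the
      payoffs over \<open>'w\<close>, and the upper bound covers the payoffs over both
      types.\<close>
    have "ereal (h t x) \<in> payoffs TYPE('w) T \<alpha> b B L hbar t x"
      unfolding payoffs_def using adm eq by blast
    then show "ereal (h t x) = Sup (payoffs TYPE('w) T \<alpha> b B L hbar t x \<union>
        payoffs TYPE('v) T \<alpha> b B L hbar t x)"
      by (auto intro!: antisym Sup_upper Sup_least intro: payoffs_le_hjb_solution[OF assms(7,8,6)])
  qed
qed

end
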